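(* Let $T$ be a tree of order at least $3$. If $\Delta(T)$ is odd and $T$ is not $(3^p-2)$-regular for any integer $p\geq 2$, then $\chi'_g(T)\leq\Delta(T)+2$; otherwise $\chi'_g(T)\leq\Delta(T)+3$.
   Context: For an integer $r\geq 2$, a tree is $r$-regular if each of its non-leaf vertices has degree $r$. For an Abelian group $\mathcal{G}$ (written additively), a $\mathcal{G}$-twin edge coloring of a graph $G$ is a proper edge labeling $f:E(G)\to\mathcal{G}$ (adjacent edges receive distinct labels) such that the weighted degrees $w(v)=\sum_{u\in N(v)}f(uv)$ satisfy $w(u)\neq w(v)$ for every edge $uv$. The group twin chromatic index $\chi'_g(G)$ is the least integer $k\geq 2$ such that $G$ has a $\mathcal{G}$-twin edge coloring for every Abelian group $\mathcal{G}$ of order $k$. $\Delta(T)$ is the maximum degree. *)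

theory Defs
  imports
    "Graph_Theory.Graph_Theory"
    "HOL-Algebra.Group"
    "HOL-Algebra.FiniteProduct"
    "HOL-Algebra.Coset"
    "HOL-Library.Extended_Nat"
begin

(* Finite simple graphs are the symmetric, loop-free, finite pair digraphs (locale pair_graph);
   an undirected edge is represented by both of its arcs (u,v) and (v,u), and written {u,v}. *)

definition edges :: "'a pair_pre_digraph \<Rightarrow> 'a set set" where
  "edges G = {{u, v} | u v. (u, v) \<in> parcs G}"

definition neighbors :: "'a pair_pre_digraph \<Rightarrow> 'a \<Rightarrow> 'a set" where
  "neighbors G v = {u. (v, u) \<in> parcs G}"

(* In a symmetric digraph the number of arcs leaving v is the undirected degree of v. *)
abbreviation vdegree :: "'a pair_pre_digraph \<Rightarrow> 'a \<Rightarrow> nat" where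
  "vdegree G v \<equiv> out_degree (with_proj G) v"

definition max_degree :: "'a pair_pre_digraph \<Rightarrow> nat" where
  "max_degree G = Max (vdegree G ` pverts G)"

(* Digraph_Component.tree is not usable for symmetric digraphs: there the closed walk u, v, u along
   a single edge counts as a cycle. The cycles of an undirected simple graph are exactly those of
   length at least 3. *)
definition undirected_tree :: "'a pair_pre_digraph \<Rightarrow> bool" where
  "undirected_tree G \<longleftrightarrow>
     pair_graph G \<and> connected (with_proj G) \<and>
     \<not> (\<exists>p. pre_digraph.cycle (with_proj G) p \<and> 3 \<le> length p)"

definition regular_tree :: "nat \<Rightarrow> 'a pair_pre_digraph \<Rightarrow> bool" where
  "regular_tree r T \<longleftrightarrow>
     2 \<le> r \<and> undirected_tree T \<and> (\<forall>v \<in> pverts T. vdegree T v \<noteq> 1 \<longrightarrow> vdegree T v = r)"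

(* HOL-Algebra groups are written multiplicatively, so the sum over N(v) is a finprod. *)
definition weighted_degree ::
  "('g, 'm) monoid_scheme \<Rightarrow> 'a pair_pre_digraph \<Rightarrow> ('a set \<Rightarrow> 'g) \<Rightarrow> 'a \<Rightarrow> 'g" where
  "weighted_degree A G f v = finprod A (\<lambda>u. f {u, v}) (neighbors G v)"

definition proper_edge_labeling ::
  "('g, 'm) monoid_scheme \<Rightarrow> 'a pair_pre_digraph \<Rightarrow> ('a set \<Rightarrow> 'g) \<Rightarrow> bool" where
  "proper_edge_labeling A G f \<longleftrightarrow>
     (\<forall>e \<in> edges G. f e \<in> carrier A) \<and>
     (\<forall>e \<in> edges G. \<forall>e' \<in> edges G. e \<noteq> e' \<and> e \<inter> e' \<noteq> {} \<longrightarrow> f e \<noteq> f e')"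

definition twin_edge_coloring ::
  "('g, 'm) monoid_scheme \<Rightarrow> 'a pair_pre_digraph \<Rightarrow> ('a set \<Rightarrow> 'g) \<Rightarrow> bool" where
  "twin_edge_coloring A G f \<longleftrightarrow>
     proper_edge_labeling A G f \<and>
     (\<forall>u v. {u, v} \<in> edges G \<longrightarrow> weighted_degree A G f u \<noteq> weighted_degree A G f v)"

(* A definition cannot quantify over the type of group elements. Every finite group is isomorphic
   to one whose elements are natural numbers, so it suffices to let A range over those; see
   twin_colorable_all_groups below. *)
definition twin_colorable :: "'a pair_pre_digraph \<Rightarrow> nat \<Rightarrow> bool" where
  "twin_colorable G k \<longleftrightarrow>
     (\<forall>A :: nat monoid. comm_group A \<and> order A = k \<longrightarrow> (\<exists>f. twin_edge_coloring A G f))"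

(* The infimum is a minimum when some admissible k exists, and \<infinity> otherwise; a finite
   upper bound therefore asserts existence as well. *)
definition group_twin_chromatic_index :: "'a pair_pre_digraph \<Rightarrow> enat" where
  "group_twin_chromatic_index G = Inf {enat k | k. 2 \<le> k \<and> twin_colorable G k}"

lemma twin_edge_coloring_iso:
  assumes G: "pair_graph G" and A: "comm_group A" and B: "comm_group B"
    and h: "h \<in> iso A B" and f: "twin_edge_coloring A G f"
  shows "twin_edge_coloring B G (h \<circ> f)"
proof -
  interpret G: pair_graph G by fact
  interpret A: comm_group A by fact
  interpret B: comm_group B by fact
  have hom: "h \<in> hom A B" and inj: "inj_on h (carrier A)"
    using h by (auto simp: iso_def bij_betw_def)
  have hc: "h x \<in> carrier B" if "x \<in> carrier A" for x
    using hom that by (auto simp: hom_def)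
  have fc: "f e \<in> carrier A" if "e \<in> edges G" for e
    using f that by (auto simp: twin_edge_coloring_def proper_edge_labeling_def)
  have nb: "{u, v} \<in> edges G" if "u \<in> neighbors G v" for u v
    using that unfolding neighbors_def edges_def by (auto simp: insert_commute)
  have wc: "weighted_degree A G f v \<in> carrier A" for v
    unfolding weighted_degree_def by (rule A.finprod_closed) (auto intro: fc nb)
  have hprod: "h (finprod A g S) = finprod B (\<lambda>x. h (g x)) S"
    if "finite S" "\<forall>x\<in>S. g x \<in> carrier A" for g and S :: "'a set"
    using that
  proof (induction S rule: finite_induct)
    case empty
    show ?case using hom_one[OF hom A.is_group B.is_group] by simp
  next
    case (insert x S)
    have gS: "g \<in> S \<rightarrow> carrier A" and gx: "g x \<in> carrier A"
      and hS: "(\<lambda>x. h (g x)) \<in> S \<rightarrow> carrier B" and hx: "h (g x) \<in> carrier B"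
      using insert.prems hc by auto
    have "h (finprod A g (insert x S)) = h (g x \<otimes>\<^bsub>A\<^esub> finprod A g S)"
      by (simp add: A.finprod_insert insert.hyps gS gx)
    also have "\<dots> = h (g x) \<otimes>\<^bsub>B\<^esub> h (finprod A g S)"
      by (rule hom_mult[OF hom gx A.finprod_closed[OF gS]])
    also have "\<dots> = finprod B (\<lambda>x. h (g x)) (insert x S)"
      using insert by (simp add: B.finprod_insert hS hx)
    finally show ?case .
  qed
  have fin: "finite (neighbors G v)" for v
  proof (rule finite_subset)
    show "neighbors G v \<subseteq> snd ` parcs G" by (force simp: neighbors_def)
  qed simp
  have w: "weighted_degree B G (h \<circ> f) v = h (weighted_degree A G f v)" for v
    unfolding weighted_degree_def using hprod[OF fin, of v "\<lambda>u. f {u, v}"] fc nb by simp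
  show ?thesis
    using f fc hc wc inj unfolding twin_edge_coloring_def proper_edge_labeling_def w
    by (auto simp: inj_on_eq_iff)
qed

lemma nat_copy_of_finite_comm_group:
  assumes B: "comm_group (B :: ('g, 'm) monoid_scheme)" and fin: "finite (carrier B)"
  obtains A :: "nat monoid" and h
  where "comm_group A" "order A = order B" "h \<in> iso A B"
proof -
  interpret B: comm_group B by fact
  obtain h where h: "bij_betw h {0..<card (carrier B)} (carrier B)"
    using ex_bij_betw_nat_finite[OF fin] by blast
  define N where "N = {0..<card (carrier B)}"
  define g where "g = inv_into N h"
  define A :: "nat monoid" where
    "A = \<lparr>carrier = N, mult = (\<lambda>x y. g (h x \<otimes>\<^bsub>B\<^esub> h y)), one = g \<one>\<^bsub>B\<^esub>\<rparr>"
  have hN: "bij_betw h N (carrier B)" using h by (simp add: N_def)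
  have hg: "h (g y) = y" if "y \<in> carrier B" for y
    unfolding g_def using hN that by (rule bij_betw_inv_into_right)
  have gh: "g (h x) = x" if "x \<in> N" for x
    unfolding g_def using hN that by (rule bij_betw_inv_into_left)
  have hc: "h x \<in> carrier B" if "x \<in> N" for x using hN that by (auto simp: bij_betw_def)
  have gc: "g y \<in> N" if "y \<in> carrier B" for y
    unfolding g_def using hN that by (auto simp: bij_betw_def inv_into_into)
  have "comm_group A"
  proof (rule comm_groupI)
    fix x assume x: "x \<in> carrier A"
    have "g (inv\<^bsub>B\<^esub> h x) \<in> carrier A" "g (inv\<^bsub>B\<^esub> h x) \<otimes>\<^bsub>A\<^esub> x = \<one>\<^bsub>A\<^esub>"
      using x by (simp_all add: A_def gc hc hg)
    then show "\<exists>y\<in>carrier A. y \<otimes>\<^bsub>A\<^esub> x = \<one>\<^bsub>A\<^esub>" by blast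
  qed (simp_all add: A_def gc hc hg gh B.m_ac)
  moreover have "order A = order B"
    using bij_betw_same_card[OF hN] by (simp add: order_def A_def)
  moreover have "h \<in> iso A B"
    using hN by (auto simp: iso_def hom_def A_def hc hg)
  ultimately show ?thesis using that by blast
qed

lemma twin_colorable_all_groups:
  fixes B :: "('g, 'm) monoid_scheme"
  assumes G: "pair_graph G" and k: "0 < k" and col: "twin_colorable G k"
    and B: "comm_group B" and ord: "order B = k"
  shows "\<exists>f. twin_edge_coloring B G f"
proof -
  have "finite (carrier B)" using k ord by (auto simp: order_def intro: card_ge_0_finite)
  then obtain A :: "nat monoid" and h
    where A: "comm_group A" "order A = order B" and h: "h \<in> iso A B"
    using nat_copy_of_finite_comm_group[OF B] by blast
  obtain f where "twin_edge_coloring A G f"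
    using col A ord by (auto simp: twin_colorable_def)
  from twin_edge_coloring_iso[OF G A(1) B h this] show ?thesis by blast
qed

end

theory Submission
  imports Defs "HOL-Algebra.Multiplicative_Group" "HOL-Algebra.Sylow"
begin

text \<open>
  Colour the tree outwards from a root, fixing all edges at a vertex at once; write the group
  multiplicatively. Throughout, the weight of a treated vertex \<open>u\<close> differs from the labels of the
  edges leading away from the root. If \<open>v\<close> is reached from \<open>u\<close> by an edge labelled \<open>c\<close>, its other
  edges therefore only need distinct labels other than \<open>c\<close> whose product is \<open>1\<close>: then \<open>v\<close> has
  weight \<open>c\<close>, which differs from the weight of \<open>u\<close> and from the new labels. In a group of odd order
  such sets are unions of pairs \<open>{x, x\<^sup>-\<^sup>1}\<close>, with one triple added when the size is odd. Only size
  \<open>1\<close> would force the label \<open>1\<close>; there almost any label works as long as \<open>c \<noteq> 1\<close>, so the label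
  \<open>1\<close> is never used.

  The root needs labels whose product is not among them. For \<open>\<Delta>\<close> even take groups of order
  \<open>\<Delta> + 3\<close>. For \<open>\<Delta>\<close> odd and order \<open>\<Delta> + 2\<close>, use a non-leaf of degree less than \<open>\<Delta>\<close> as root; if
  there is none, the tree is regular, the label \<open>1\<close> is harmless, and the root gets all labels except
  \<open>x\<close> and \<open>x\<^sup>-\<^sup>2\<close> for some \<open>x\<close> with \<open>x\<^sup>3 \<noteq> 1\<close>, which exists unless \<open>\<Delta> + 2\<close> is a power of \<open>3\<close>. In the
  remaining case the order is \<open>\<Delta> + 3 = 3\<^sup>p + 1\<close>, which is even but not a power of \<open>2\<close>, and the label
  sets are complements of sets of three or four elements with the same product as the whole group.
\<close>

section \<open>Neighbourhoods and connectedness\<close>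

lemma vdegree_eq_card_neighbors: "vdegree G v = card (neighbors G v)"
proof -
  have "out_arcs (with_proj G) v = Pair v ` neighbors G v"
    by (auto simp: out_arcs_def neighbors_def)
  then show ?thesis
    by (simp add: out_degree_def card_image inj_on_def)
qed

lemma (in wf_digraph) strongly_connected_ex_boundary_arc:
  assumes "strongly_connected G" "U \<subset> verts G" "U \<noteq> {}"
  shows "\<exists>u\<in>U. \<exists>v. v \<notin> U \<and> u \<rightarrow>\<^bsub>G\<^esub> v"
proof -
  obtain a b where a: "a \<in> U" and b: "b \<in> verts G" "b \<notin> U" using assms(2,3) by blast
  then have "a \<rightarrow>\<^sup>* b" using assms(1,2) by (auto simp: strongly_connected_def)
  then show ?thesis using a b(2) by (induction rule: reachable_induct) blast+
qed

lemma (in sym_digraph) strongly_connected_induce_insert: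
  assumes sc: "strongly_connected (G \<restriction> U)" and u: "u \<in> U" and uv: "u \<rightarrow>\<^bsub>G\<^esub> v"
  shows "strongly_connected (G \<restriction> insert v U)"
proof -
  let ?H = "G \<restriction> insert v U"
  interpret H: wf_digraph ?H by (rule wellformed_induce_subgraph)
  have "v \<rightarrow>\<^bsub>G\<^esub> u" using uv sym_arcs by (auto simp: symmetric_def dest: symD)
  then have adj: "u \<rightarrow>\<^bsub>?H\<^esub> v" "v \<rightarrow>\<^bsub>?H\<^esub> u" using uv u by (auto simp: arcs_ends_conv)
  have within: "a \<rightarrow>\<^sup>*\<^bsub>?H\<^esub> b" if "a \<in> U" "b \<in> U" for a b
    by (rule reachable_induce_ss[where S = U]) (use sc that in \<open>auto simp: strongly_connected_def\<close>)
  have to_u: "a \<rightarrow>\<^sup>*\<^bsub>?H\<^esub> u" and from_u: "u \<rightarrow>\<^sup>*\<^bsub>?H\<^esub> a" if "a \<in> insert v U" for a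
    using that within[OF _ u] within[OF u] adj by auto
  have "a \<rightarrow>\<^sup>*\<^bsub>?H\<^esub> b" if "a \<in> insert v U" "b \<in> insert v U" for a b
    using to_u[OF that(1)] from_u[OF that(2)] by (rule H.reachable_trans)
  then show ?thesis by (simp add: strongly_connected_def)
qed

context pair_graph
begin

lemma neighbors_sym: "u \<in> neighbors G v \<longleftrightarrow> v \<in> neighbors G u"
  using pair_sym_arcs by (auto simp: neighbors_def symmetric_def sym_def)

lemma neighbors_irrefl: "v \<notin> neighbors G v"
  by (auto simp: neighbors_def dest: pair_no_loops)

lemma neighbors_subset_pverts: "neighbors G v \<subseteq> pverts G"
  by (auto simp: neighbors_def in_arcsD2)

lemma neighbors_eq_empty: "v \<notin> pverts G \<Longrightarrow> neighbors G v = {}"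
  by (auto simp: neighbors_def in_arcsD1)

lemma finite_neighbors: "finite (neighbors G v)"
  using neighbors_subset_pverts pair_finite_verts by (rule finite_subset)

lemma in_edges_iff: "{u, v} \<in> edges G \<longleftrightarrow> u \<in> neighbors G v"
  using neighbors_sym[of u v] by (auto simp: edges_def neighbors_def doubleton_eq_iff)

lemma edge_at_vertex:
  assumes "e \<in> edges G" "v \<in> e"
  shows "\<exists>u\<in>neighbors G v. e = {u, v}"
proof -
  obtain a b where e: "e = {a, b}" "b \<in> neighbors G a"
    using assms(1) by (auto simp: edges_def neighbors_def)
  moreover have "a \<in> neighbors G b" using e(2) neighbors_sym by blast
  ultimately show ?thesis using assms(2) by (auto simp: insert_commute)
qed

lemma ex_cycle_if_two_neighbors:
  assumes sc: "strongly_connected (with_proj G \<restriction> U)" and U: "U \<subseteq> pverts G" "v \<notin> U"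
    and xy: "x \<in> neighbors G v \<inter> U" "y \<in> neighbors G v \<inter> U" "x \<noteq> y"
  shows "\<exists>p. cycle p \<and> 3 \<le> length p"
proof -
  let ?H = "with_proj G \<restriction> U"
  interpret H: wf_digraph ?H by (rule wellformed_induce_subgraph)
  have "x \<rightarrow>\<^sup>*\<^bsub>?H\<^esub> y" using sc xy by (auto simp: strongly_connected_def)
  then obtain p where path: "H.apath x p y" unfolding H.reachable_apath by blast
  then have p: "awalk x p y" "distinct (awalk_verts x p)"
    using subgraph_apath_imp_apath[OF _ subgraph_induce_subgraphI] U by (auto simp: apath_def)
  have verts_p: "set (awalk_verts x p) \<subseteq> U"
    using path awalk_verts_induce[of U] by (simp add: H.apath_def H.awalk_conv)
  have arcs: "(v, x) \<in> parcs G" "(y, v) \<in> parcs G"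
    using xy neighbors_sym[of y v] by (auto simp: neighbors_def)
  let ?c = "(v, x) # p @ [(y, v)]"
  have last: "awalk y [(y, v)] v" using arcs by (simp add: awalk_simps in_arcsD2)
  have walk: "awalk x (p @ [(y, v)]) v" by (rule awalk_appendI[OF p(1) last])
  then have "awalk v ?c v" using arcs by (simp add: awalk_Cons_iff del: awalk_append_iff)
  moreover have "awalk_verts v ?c = v # awalk_verts x p @ [v]"
    using awalk_verts_append[OF walk] by simp
  then have "distinct (tl (awalk_verts v ?c))" using p(2) verts_p U(2) by auto
  ultimately have "cycle ?c" unfolding cycle_def by blast
  moreover have "p \<noteq> []" using p(1) xy(3) by (auto simp: awalk_Nil_iff)
  then have "3 \<le> length ?c" by (cases p) auto
  ultimately show ?thesis by blast
qed

lemma connected_imp_strongly_connected: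
  "connected (with_proj G) \<Longrightarrow> strongly_connected (with_proj G)"
  using sym_arcs by (rule symmetric_connected_imp_strongly_connected)

lemma connected_ex_boundary_edge:
  assumes "connected (with_proj G)" "U \<subset> pverts G" "U \<noteq> {}"
  shows "\<exists>u\<in>U. \<exists>v\<in>neighbors G u. v \<notin> U"
  using strongly_connected_ex_boundary_arc[OF connected_imp_strongly_connected[OF assms(1)], of U]
    assms(2,3) by (auto simp: neighbors_def)

lemma connected_vdegree_pos:
  assumes con: "connected (with_proj G)" and card: "2 \<le> card (pverts G)" and v: "v \<in> pverts G"
  shows "0 < vdegree G v"
proof -
  have "pverts G \<noteq> {v}" using card by auto
  then have "{v} \<subset> pverts G" using v by auto
  then have "neighbors G v \<noteq> {}" using connected_ex_boundary_edge[OF con, of "{v}"] by blast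
  then show ?thesis
    using finite_neighbors[of v] by (simp add: vdegree_eq_card_neighbors card_gt_0_iff)
qed

lemma connected_ex_vdegree_ge_2:
  assumes con: "connected (with_proj G)" and card: "3 \<le> card (pverts G)"
  shows "\<exists>v\<in>pverts G. 2 \<le> vdegree G v"
proof -
  have two: "2 \<le> vdegree G v" if "a \<in> neighbors G v" "b \<in> neighbors G v" "a \<noteq> b" for a b v
    using card_mono[OF finite_neighbors, of "{a, b}" v] that
    by (simp add: vdegree_eq_card_neighbors)
  obtain v where v: "v \<in> pverts G" using card by fastforce
  have "pverts G \<noteq> {v}" using card by auto
  then have "{v} \<subset> pverts G" using v by auto
  then obtain u where u: "u \<in> neighbors G v"
    using connected_ex_boundary_edge[OF con, of "{v}"] by blast
  then have "u \<in> pverts G" using neighbors_subset_pverts by blast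
  have "pverts G \<noteq> {v, u}" using card by (auto simp: card_insert_if split: if_splits)
  then have "{v, u} \<subset> pverts G" using v \<open>u \<in> pverts G\<close> by auto
  then obtain w x where "w \<in> {v, u}" "x \<notin> {v, u}" "x \<in> neighbors G w"
    using connected_ex_boundary_edge[OF con, of "{v, u}"] by blast
  moreover have "v \<in> neighbors G u" using u neighbors_sym by blast
  ultimately have "2 \<le> vdegree G v \<or> 2 \<le> vdegree G u" using u two[of x] by blast
  then show ?thesis using v \<open>u \<in> pverts G\<close> by blast
qed

end

section \<open>Growing a tree from a root\<close>

lemma undirected_treeD:
  assumes "undirected_tree T"
  shows "pair_graph T" "connected (with_proj T)"
  using assms by (simp_all add: undirected_tree_def)

lemma regular_tree_imp_undirected_tree: "regular_tree d T \<Longrightarrow> undirected_tree T"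
  by (simp add: regular_tree_def)

lemma undirected_tree_neighbors_Int:
  assumes T: "undirected_tree T" and sc: "strongly_connected (with_proj T \<restriction> U)"
    and U: "U \<subseteq> pverts T" "v \<notin> U" and u: "u \<in> U" "u \<in> neighbors T v"
  shows "neighbors T v \<inter> U = {u}"
proof -
  interpret pair_graph T using T by (rule undirected_treeD)
  have "x = u" if "x \<in> neighbors T v \<inter> U" for x
    using ex_cycle_if_two_neighbors[OF sc U that, of u] u T by (auto simp: undirected_tree_def)
  then show ?thesis using u by blast
qed

lemma undirected_tree_induct [consumes 2, case_names root grow]:
  assumes T: "undirected_tree T" and r: "r \<in> pverts T"
    and root: "P {r}"
    and grow: "\<And>U u v. \<lbrakk>r \<in> U; U \<subseteq> pverts T; v \<in> pverts T - U; neighbors T v \<inter> U = {u}; P U\<rbrakk>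
                 \<Longrightarrow> P (insert v U)"
  shows "P (pverts T)"
proof -
  interpret pair_graph T using T by (rule undirected_treeD)
  have con: "connected (with_proj T)" using T by (rule undirected_treeD)
  have "P (pverts T)"
    if "r \<in> U" "U \<subseteq> pverts T" "strongly_connected (with_proj T \<restriction> U)" "P U" for U
    using that
  proof (induction "card (pverts T - U)" arbitrary: U rule: less_induct)
    case less
    show ?case
    proof (cases "U = pverts T")
      case False
      then obtain u v where uv: "u \<in> U" "v \<in> pverts T - U" "v \<in> neighbors T u"
        using connected_ex_boundary_edge[OF con, of U] less.prems neighbors_subset_pverts by blast
      then have "u \<in> neighbors T v" using neighbors_sym by blast
      then have "neighbors T v \<inter> U = {u}"
        using undirected_tree_neighbors_Int[OF T] less.prems uv by blast
      then have "P (insert v U)" using grow less.prems uv by blast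
      moreover have "card (pverts T - insert v U) < card (pverts T - U)"
        using uv by (intro psubset_card_mono) auto
      moreover have "strongly_connected (with_proj T \<restriction> insert v U)"
        using strongly_connected_induce_insert[OF less.prems(3) uv(1)] uv(3)
        by (simp add: neighbors_def)
      ultimately show ?thesis using less.hyps[of "insert v U"] less.prems(1,2) uv by blast
    qed (use less.prems in simp)
  qed
  moreover have "strongly_connected (with_proj T \<restriction> {r})"
    using wf_digraph.reachable_refl[OF wellformed_induce_subgraph]
    by (simp add: strongly_connected_def)
  ultimately show ?thesis using r root by blast
qed

section \<open>Elements of finite abelian groups\<close>

lemma ex_mem_not_mem_if_card_less: "\<lbrakk>finite X; card X < card A\<rbrakk> \<Longrightarrow> \<exists>a\<in>A. a \<notin> X"
  by (meson card_mono leD subsetI)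

context group
begin

lemma pow_numeral_2: "x \<in> carrier G \<Longrightarrow> x [^] (2::nat) = x \<otimes> x"
  by (simp add: numeral_2_eq_2)

lemma ex_element_of_prime_order:
  assumes fin: "finite (carrier G)" and p: "prime p" "p dvd order G"
  shows "\<exists>x\<in>carrier G. ord x = p"
proof -
  obtain m where "order G = p ^ 1 * m" using p(2) by auto
  then obtain H where H: "subgroup H G" "card H = p"
    using sylow_thm[OF p(1) is_group _ fin, of 1 m] by auto
  have "\<not> H \<subseteq> {\<one>}"
    using H(2) card_mono[of "{\<one>}" H] prime_gt_1_nat[OF p(1)] by auto
  then obtain x where x: "x \<in> H" "x \<noteq> \<one>" by blast
  then have xG: "x \<in> carrier G" using H(1) subgroup.subset by blast
  interpret H: group "G\<lparr>carrier := H\<rparr>" using H(1) by (rule subgroup.subgroup_is_group) simp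
  have "x [^] p = \<one>"
    using H.pow_order_eq_1[of x] x H(2) by (simp add: order_def nat_pow_consistent[symmetric])
  then have "ord x dvd p" using pow_eq_id xG by blast
  then have "ord x = p" using p(1) x(2) ord_eq_1[OF xG] by (auto simp: prime_nat_iff)
  then show ?thesis using xG by blast
qed

lemma ex_pow_prime_neq_one:
  assumes fin: "finite (carrier G)" and q: "prime q" and ord: "\<And>k. order G \<noteq> q ^ k"
  shows "\<exists>x\<in>carrier G. x [^] q \<noteq> \<one>"
proof -
  have "order G \<noteq> 0" using fin order_gt_0_iff_finite by simp
  then obtain m where m: "order G = q ^ multiplicity q (order G) * m" "\<not> q dvd m"
    using multiplicity_decompose'[of "order G" q] q by (metis not_prime_unit)
  then have "m \<noteq> 1" using ord by (metis mult.right_neutral)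
  then obtain p where p: "prime p" "p dvd m" using prime_factor_nat by blast
  then have "p dvd order G" using m(1) by (metis dvd_mult)
  then obtain x where x: "x \<in> carrier G" "ord x = p"
    using ex_element_of_prime_order[OF fin p(1)] by blast
  have "p \<noteq> q" using p(2) m(2) by blast
  then have "\<not> ord x dvd q" using x(2) p(1) q primes_dvd_imp_eq by blast
  then show ?thesis using x(1) pow_eq_id by blast
qed

lemma odd_order_square_eq_one:
  assumes "odd (order G)" "x \<in> carrier G" "x \<otimes> x = \<one>"
  shows "x = \<one>"
proof -
  have "ord x dvd 2" using assms(2,3) by (simp add: pow_eq_id[symmetric] pow_numeral_2)
  moreover have "odd (ord x)" using assms(1,2) ord_dvd_group_order dvd_trans by blast
  ultimately have "ord x = 1" using two_is_prime_nat by (auto simp: prime_nat_iff)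
  then show ?thesis using ord_eq_1 assms(2) by blast
qed

lemma odd_order_inv_neq:
  assumes "odd (order G)" "x \<in> carrier G" "x \<noteq> \<one>"
  shows "inv x \<noteq> x"
  using assms odd_order_square_eq_one[of x] r_inv[of x] by metis

end

locale finite_comm_group = comm_group +
  assumes finite_carrier: "finite (carrier G)"
begin

lemma finite_if_subset_carrier: "X \<subseteq> carrier G \<Longrightarrow> finite X"
  using finite_carrier finite_subset by blast

lemma card_carrier_Diff: "X \<subseteq> carrier G \<Longrightarrow> card (carrier G - X) = order G - card X"
  by (simp add: card_Diff_subset finite_if_subset_carrier order_def)

lemma finprod_subset_closed: "X \<subseteq> carrier G \<Longrightarrow> (\<Otimes>x\<in>X. x) \<in> carrier G"
  by (intro finprod_closed) auto

lemma finprod_carrier_Diff: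
  assumes "X \<subseteq> carrier G"
  shows "(\<Otimes>x\<in>carrier G - X. x) = (\<Otimes>x\<in>carrier G. x) \<otimes> inv (\<Otimes>x\<in>X. x)"
proof -
  have X: "(\<Otimes>x\<in>X. x) \<in> carrier G" using assms by (rule finprod_subset_closed)
  have D: "(\<Otimes>x\<in>carrier G - X. x) \<in> carrier G" by (rule finprod_subset_closed) blast
  have "(\<Otimes>x\<in>(carrier G - X) \<union> X. x) = (\<Otimes>x\<in>carrier G - X. x) \<otimes> (\<Otimes>x\<in>X. x)"
    using assms finite_carrier finite_if_subset_carrier by (intro finprod_Un_disjoint) auto
  moreover have "(carrier G - X) \<union> X = carrier G" using assms by blast
  ultimately show ?thesis using X D by (simp add: m_assoc)
qed

lemma odd_order_finprod_carrier:
  assumes odd: "odd (order G)"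
  shows "(\<Otimes>x\<in>carrier G. x) = \<one>"
proof -
  let ?s = "\<Otimes>x\<in>carrier G. x"
  have "inj_on (\<lambda>x. inv x) (carrier G)" using inv_inj by simp
  moreover have "(\<lambda>x. inv x) ` carrier G = carrier G"
    by (intro endo_inj_surj finite_carrier) (auto simp: inv_inj)
  ultimately have "?s = (\<Otimes>x\<in>carrier G. inv x)"
    using finprod_reindex[of "\<lambda>x. x" "\<lambda>x. inv x" "carrier G"] by simp
  then have "?s \<otimes> ?s = (\<Otimes>x\<in>carrier G. x \<otimes> inv x)"
    by (simp add: finprod_multf)
  also have "\<dots> = \<one>" by (intro finprod_one_eqI) simp
  finally have "?s \<otimes> ?s = \<one>" .
  then show ?thesis using odd_order_square_eq_one[OF odd finprod_subset_closed] by blast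
qed

lemma odd_order_inj_on_square:
  assumes "odd (order G)"
  shows "inj_on (\<lambda>x. x \<otimes> x) (carrier G)"
proof (rule inj_onI)
  fix a b assume G: "a \<in> carrier G" "b \<in> carrier G" and eq: "a \<otimes> a = b \<otimes> b"
  have "(a \<otimes> inv b) \<otimes> (a \<otimes> inv b) = (a \<otimes> a) \<otimes> inv (b \<otimes> b)"
    using G by (simp add: inv_mult m_ac)
  also have "\<dots> = \<one>" using G by (simp add: eq)
  finally have "a \<otimes> inv b = \<one>"
    using odd_order_square_eq_one[OF assms m_closed] G by blast
  then show "a = b" using G by (simp add: inv_solve_right')
qed

lemma card_square_roots_le_half:
  assumes a: "a \<in> carrier G" "a \<otimes> a \<noteq> \<one>" and s: "s \<in> carrier G"
  shows "2 * card {y \<in> carrier G. y \<otimes> y = s} \<le> order G"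
proof -
  let ?B = "{y \<in> carrier G. y \<otimes> y = s}"
  have "(\<lambda>y. y \<otimes> a) ` ?B \<subseteq> carrier G - ?B"
  proof (intro image_subsetI DiffI notI)
    fix y assume "y \<in> ?B"
    then have y: "y \<in> carrier G" "y \<otimes> y = s" by auto
    show "y \<otimes> a \<in> carrier G" using y a by simp
    assume "y \<otimes> a \<in> ?B"
    then have "s \<otimes> (a \<otimes> a) = s" using y a by (auto simp: m_ac)
    then show False using s a by simp
  qed
  moreover have "inj_on (\<lambda>y. y \<otimes> a) ?B" using a by (auto simp: inj_on_def)
  ultimately have "card ?B \<le> card (carrier G - ?B)"
    using finite_carrier by (intro card_inj_on_le) auto
  also have "\<dots> = order G - card ?B" by (rule card_carrier_Diff) blast
  finally show ?thesis
    using finite_carrier card_mono[of "carrier G" ?B] by (auto simp: order_def)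
qed

lemma even_order_card_squares_le_half:
  assumes even: "even (order G)"
  shows "2 * card ((\<lambda>x. x \<otimes> x) ` carrier G) \<le> order G"
proof -
  let ?fibre = "\<lambda>y. {x \<in> carrier G. x \<otimes> x = y}"
  obtain t where t: "t \<in> carrier G" "ord t = 2"
    using ex_element_of_prime_order[OF finite_carrier two_is_prime_nat] even by blast
  have t_square: "t \<otimes> t = \<one>" using pow_ord_eq_1[OF t(1)] unfolding t(2) pow_numeral_2[OF t(1)] .
  have "t \<noteq> \<one>" using ord_eq_1[OF t(1)] unfolding t(2) by simp
  have fibre: "2 \<le> card (?fibre (x \<otimes> x))" if x: "x \<in> carrier G" for x
  proof -
    have "(t \<otimes> x) \<otimes> (t \<otimes> x) = (t \<otimes> t) \<otimes> (x \<otimes> x)" using t(1) x by (simp add: m_ac)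
    then have "{x, t \<otimes> x} \<subseteq> ?fibre (x \<otimes> x)" using t(1) x t_square by simp
    moreover have "t \<otimes> x \<noteq> x" using t(1) x \<open>t \<noteq> \<one>\<close> by simp
    ultimately show ?thesis
      using card_mono[of "?fibre (x \<otimes> x)" "{x, t \<otimes> x}"] finite_carrier by simp
  qed
  have "(\<Sum>y\<in>(\<lambda>x. x \<otimes> x) ` carrier G. 2) \<le> (\<Sum>y\<in>(\<lambda>x. x \<otimes> x) ` carrier G. card (?fibre y))"
    by (rule sum_mono, erule imageE) (simp only: fibre)
  also have "\<dots> = order G"
    using sum.image_gen[OF finite_carrier, of "\<lambda>_. 1::nat" "\<lambda>x. x \<otimes> x"] by (simp add: order_def)
  finally show ?thesis by simp
qed

lemma even_order_ex_nonsquare: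
  assumes "even (order G)" "2 < order G"
  shows "\<exists>e\<in>carrier G. e \<noteq> a \<and> (\<forall>x\<in>carrier G. x \<otimes> x \<noteq> e)"
proof -
  let ?Q = "(\<lambda>x. x \<otimes> x) ` carrier G"
  have "card (insert a ?Q) \<le> Suc (card ?Q)" using finite_carrier by (simp add: card_insert_if)
  also have "\<dots> < card (carrier G)"
    using even_order_card_squares_le_half assms by (simp add: order_def)
  finally have "\<exists>e\<in>carrier G. e \<notin> insert a ?Q"
    using finite_carrier by (intro ex_mem_not_mem_if_card_less) auto
  then show ?thesis by blast
qed

lemma ex_distinct_factorization:
  assumes e: "e \<in> carrier G" and F: "F \<subseteq> carrier G"
    and card: "card (F \<union> (\<lambda>x. e \<otimes> inv x) ` F) + card {x \<in> carrier G. x \<otimes> x = e} < order G"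
  shows "\<exists>x\<in>carrier G - F. \<exists>y\<in>carrier G - F. x \<noteq> y \<and> x \<otimes> y = e"
proof -
  let ?X = "F \<union> (\<lambda>x. e \<otimes> inv x) ` F \<union> {x \<in> carrier G. x \<otimes> x = e}"
  have "card ?X < card (carrier G)"
    using card card_Un_le[of "F \<union> (\<lambda>x. e \<otimes> inv x) ` F" "{x \<in> carrier G. x \<otimes> x = e}"]
    unfolding order_def by linarith
  moreover have "finite ?X" using finite_carrier finite_if_subset_carrier[OF F] by simp
  ultimately obtain x where x: "x \<in> carrier G" "x \<notin> ?X"
    using ex_mem_not_mem_if_card_less[of ?X "carrier G"] by blast
  define y where "y = e \<otimes> inv x"
  have y: "y \<in> carrier G" and xy: "x \<otimes> y = e"
    using e x(1) by (simp_all add: y_def m_lcomm)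
  then have "x = e \<otimes> inv y" using e x(1) by (simp add: inv_solve_right)
  then have "y \<notin> F" using x(2) by blast
  moreover have "x \<noteq> y" using xy x by blast
  ultimately show ?thesis using x y xy by blast
qed

end

section \<open>Subsets of finite abelian groups with product one\<close>

context finite_comm_group
begin

definition has_unit_subset :: "'a set \<Rightarrow> nat \<Rightarrow> bool" where
  "has_unit_subset X m \<longleftrightarrow> (\<exists>S\<subseteq>X. card S = m \<and> (\<Otimes>x\<in>S. x) = \<one>)"

lemma has_unit_subset_0: "has_unit_subset X 0"
  unfolding has_unit_subset_def by (rule exI[of _ "{}"]) simp

lemma has_unit_subset_mono: "\<lbrakk>has_unit_subset X m; X \<subseteq> Y\<rbrakk> \<Longrightarrow> has_unit_subset Y m"
  unfolding has_unit_subset_def by blast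

lemma has_unit_subset_Un:
  assumes "has_unit_subset X m" "has_unit_subset Y n"
    and "X \<inter> Y = {}" "X \<subseteq> carrier G" "Y \<subseteq> carrier G"
  shows "has_unit_subset (X \<union> Y) (m + n)"
proof -
  obtain S where S: "S \<subseteq> X" "card S = m" "(\<Otimes>x\<in>S. x) = \<one>"
    using assms(1) unfolding has_unit_subset_def by blast
  obtain R where R: "R \<subseteq> Y" "card R = n" "(\<Otimes>x\<in>R. x) = \<one>"
    using assms(2) unfolding has_unit_subset_def by blast
  have fin: "finite S" "finite R"
    using S(1) R(1) assms(4,5) by (meson finite_if_subset_carrier subset_trans)+
  have disj: "S \<inter> R = {}" using S(1) R(1) assms(3) by blast
  have "(\<Otimes>x\<in>S \<union> R. x) = (\<Otimes>x\<in>S. x) \<otimes> (\<Otimes>x\<in>R. x)"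
    using fin disj S(1) R(1) assms(4,5) by (intro finprod_Un_disjoint) auto
  then have "(\<Otimes>x\<in>S \<union> R. x) = \<one>" using S(3) R(3) by simp
  moreover have "card (S \<union> R) = m + n" using fin disj S(2) R(2) by (simp add: card_Un_disjoint)
  ultimately show ?thesis
    unfolding has_unit_subset_def using S(1) R(1) by (intro exI[of _ "S \<union> R"]) blast
qed

lemma has_unit_subset_inverse_pair:
  assumes "x \<in> carrier G" "inv x \<noteq> x"
  shows "has_unit_subset {x, inv x} 2"
proof -
  have "(\<Otimes>y\<in>{x, inv x}. y) = \<one>" using assms by simp
  then show ?thesis
    unfolding has_unit_subset_def using assms(2) by (intro exI[of _ "{x, inv x}"]) auto
qed

lemma has_unit_subset_if_inv_closed:
  assumes "X \<subseteq> carrier G" "\<And>x. x \<in> X \<Longrightarrow> inv x \<in> X" "\<And>x. x \<in> X \<Longrightarrow> inv x \<noteq> x"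
    and "2 * j \<le> card X"
  shows "has_unit_subset X (2 * j)"
  using assms
proof (induction j arbitrary: X)
  case 0
  show ?case using has_unit_subset_0 by simp
next
  case (Suc j)
  obtain x where x: "x \<in> X" using Suc.prems(4) by fastforce
  have xG: "x \<in> carrier G" using x Suc.prems(1) by blast
  let ?X = "X - {x, inv x}"
  have "{x, inv x} \<subseteq> X" using x Suc.prems(2) by blast
  then have "card ?X = card X - 2"
    using card_Diff_subset[of "{x, inv x}" X] Suc.prems(3)[OF x] by simp
  moreover have "inv y \<in> ?X" if y: "y \<in> ?X" for y
  proof -
    have "y \<in> carrier G" using y Suc.prems(1) by blast
    then show ?thesis
      using y Suc.prems(2) xG inv_inv by (metis DiffD1 DiffD2 DiffI insert_iff empty_iff)
  qed
  ultimately have "has_unit_subset ?X (2 * j)"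
    using Suc.prems by (intro Suc.IH) auto
  then have "has_unit_subset (?X \<union> {x, inv x}) (2 * j + 2)"
    using Suc.prems(1,3) x xG
    by (intro has_unit_subset_Un has_unit_subset_inverse_pair) auto
  moreover have "?X \<union> {x, inv x} = X" using \<open>{x, inv x} \<subseteq> X\<close> by blast
  ultimately show ?case by simp
qed

lemma has_unit_subset_complement:
  assumes "X \<subseteq> carrier G" "(\<Otimes>x\<in>X. x) = (\<Otimes>x\<in>carrier G. x)"
  shows "has_unit_subset (carrier G - X) (order G - card X)"
proof -
  have "(\<Otimes>x\<in>X. x) \<in> carrier G" using assms(1) by (rule finprod_subset_closed)
  then have "(\<Otimes>x\<in>carrier G - X. x) = \<one>"
    using finprod_carrier_Diff[OF assms(1)] by (simp flip: assms(2))
  then show ?thesis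
    unfolding has_unit_subset_def using card_carrier_Diff[OF assms(1)] by blast
qed

lemma odd_order_has_unit_subset_Diff:
  assumes odd: "odd (order G)" and F: "\<one> \<in> F" "F \<subseteq> carrier G" "\<And>x. x \<in> F \<Longrightarrow> inv x \<in> F"
    and card: "2 * j + card F \<le> order G"
  shows "has_unit_subset (carrier G - F) (2 * j)"
proof (rule has_unit_subset_if_inv_closed)
  show "inv x \<in> carrier G - F" if "x \<in> carrier G - F" for x
    using that F(3)[of "inv x"] by auto
  show "inv x \<noteq> x" if "x \<in> carrier G - F" for x
    using odd_order_inv_neq[OF odd] that F(1) by blast
  show "2 * j \<le> card (carrier G - F)" using card_carrier_Diff[OF F(2)] card by simp
qed blast

lemma odd_order_has_even_unit_subset:
  assumes odd: "odd (order G)" and c: "c \<in> carrier G" and m: "even m" "m + 3 \<le> order G"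
  shows "has_unit_subset (carrier G - {\<one>, c}) m"
proof -
  let ?F = "{\<one>, c, inv c}"
  obtain j where j: "m = 2 * j" using m(1) by blast
  have "card ?F \<le> 3" by (simp add: card_insert_if)
  then have "has_unit_subset (carrier G - ?F) (2 * j)"
    using c j m(2) by (intro odd_order_has_unit_subset_Diff[OF odd]) auto
  then show ?thesis unfolding j by (rule has_unit_subset_mono) blast
qed

lemma odd_order_ex_distinct_factorization:
  assumes odd: "odd (order G)" and c: "c \<in> carrier G" and n: "7 \<le> order G"
  shows "\<exists>a\<in>carrier G - {\<one>, c, inv c}. \<exists>b\<in>carrier G - {\<one>, c, inv c}. a \<noteq> b \<and> a \<otimes> b = c"
proof (rule ex_distinct_factorization[OF c])
  let ?F = "{\<one>, c, inv c}"
  have "?F \<union> (\<lambda>x. c \<otimes> inv x) ` ?F = {\<one>, c, inv c, c \<otimes> c}" using c by auto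
  then have "card (?F \<union> (\<lambda>x. c \<otimes> inv x) ` ?F) \<le> 4" by (simp add: card_insert_if)
  moreover have "card {x \<in> carrier G. x \<otimes> x = c} \<le> Suc 0"
    using finite_carrier odd_order_inj_on_square[OF odd]
    by (subst card_le_Suc0_iff_eq) (auto dest: inj_onD)
  ultimately show "card (?F \<union> (\<lambda>x. c \<otimes> inv x) ` ?F) + card {x \<in> carrier G. x \<otimes> x = c} < order G"
    using n by linarith
qed (use c in auto)

lemma odd_order_has_odd_unit_subset:
  assumes odd: "odd (order G)" and c: "c \<in> carrier G" "c \<noteq> \<one>"
    and m: "odd m" "3 \<le> m" "m + 4 \<le> order G"
  shows "has_unit_subset (carrier G - {\<one>, c}) m"
proof -
  obtain a b where ab: "a \<in> carrier G - {\<one>, c, inv c}" "b \<in> carrier G - {\<one>, c, inv c}"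
    "a \<noteq> b" "a \<otimes> b = c"
    using odd_order_ex_distinct_factorization[OF odd c(1)] m by force
  \<comment> \<open>The inverse of \<open>c\<close> has to be avoided anyway; using it in the triple keeps \<open>?F\<close> small.\<close>
  let ?T = "{inv c, a, b}" and ?F = "{\<one>, c, inv c, a, inv a, b, inv b}"
  have inv_c: "inv c \<in> carrier G" "inv c \<noteq> \<one>" "inv c \<noteq> c" "inv c \<notin> {a, b}"
    using c ab(1,2) odd_order_inv_neq[OF odd c] by auto
  have "(\<Otimes>x\<in>?T. x) = inv c \<otimes> (a \<otimes> b)" using ab inv_c by simp
  then have "has_unit_subset ?T 3"
    unfolding has_unit_subset_def using ab c inv_c by (intro exI[of _ ?T]) simp
  moreover have "card ?F \<le> 7"
    using card_length[of "[\<one>, c, inv c, a, inv a, b, inv b]"] by simp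
  then have "has_unit_subset (carrier G - ?F) (2 * ((m - 3) div 2))"
    using ab c m by (intro odd_order_has_unit_subset_Diff[OF odd]) auto
  ultimately have "has_unit_subset (?T \<union> (carrier G - ?F)) (3 + 2 * ((m - 3) div 2))"
    using ab inv_c by (intro has_unit_subset_Un) auto
  then have "has_unit_subset (carrier G - {\<one>, c}) (3 + 2 * ((m - 3) div 2))"
    by (rule has_unit_subset_mono) (use ab inv_c in auto)
  moreover have "3 + 2 * ((m - 3) div 2) = m" using m(1,2) by presburger
  ultimately show ?thesis by (simp only:)
qed

lemma odd_order_has_unit_subset:
  assumes odd: "odd (order G)" and c: "c \<in> carrier G" "c \<noteq> \<one>" and m: "2 \<le> m" "m + 3 \<le> order G"
  shows "has_unit_subset (carrier G - {\<one>, c}) m"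
proof (cases "even m")
  case True
  then show ?thesis using odd_order_has_even_unit_subset odd c(1) m(2) by blast
next
  case False
  then have "3 \<le> m" "m + 4 \<le> order G" using m odd by presburger+
  then show ?thesis using odd_order_has_odd_unit_subset[OF odd c False] by blast
qed

lemma ex_triple_with_product:
  assumes n: "5 \<le> order G" and a: "a \<in> carrier G" "a \<otimes> a \<noteq> \<one>" and s: "s \<in> carrier G"
  shows "\<exists>X\<subseteq>carrier G. \<one> \<in> X \<and> card X = 3 \<and> (\<Otimes>x\<in>X. x) = s"
proof -
  have "card ({\<one>} \<union> (\<lambda>x. s \<otimes> inv x) ` {\<one>}) \<le> 2" by (simp add: card_insert_if)
  then have "card ({\<one>} \<union> (\<lambda>x. s \<otimes> inv x) ` {\<one>}) + card {x \<in> carrier G. x \<otimes> x = s} < order G"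
    using card_square_roots_le_half[OF a s] n by linarith
  then obtain x y where "x \<in> carrier G - {\<one>}" "y \<in> carrier G - {\<one>}" "x \<noteq> y" "x \<otimes> y = s"
    using ex_distinct_factorization[OF s, of "{\<one>}"] one_closed by blast
  then show ?thesis by (intro exI[of _ "{\<one>, x, y}"]) auto
qed

lemma has_unit_subset_order_minus_3:
  assumes "5 \<le> order G" "a \<in> carrier G" "a \<otimes> a \<noteq> \<one>"
  shows "has_unit_subset (carrier G - {\<one>}) (order G - 3)"
proof -
  obtain X where X: "X \<subseteq> carrier G" "\<one> \<in> X" "card X = 3" "(\<Otimes>x\<in>X. x) = (\<Otimes>x\<in>carrier G. x)"
    using ex_triple_with_product[OF assms finprod_subset_closed[OF subset_refl]] by blast
  then have "has_unit_subset (carrier G - X) (order G - 3)"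
    using has_unit_subset_complement[OF X(1,4)] by (simp only: X(3))
  then show ?thesis by (rule has_unit_subset_mono) (use X in blast)
qed

lemma even_order_ex_quadruple_with_product:
  assumes n: "even (order G)" "5 \<le> order G" and c: "c \<in> carrier G" and s: "s \<in> carrier G"
  shows "\<exists>X\<subseteq>carrier G. c \<in> X \<and> card X = 4 \<and> (\<Otimes>x\<in>X. x) = s"
proof -
  have "2 < order G" using n(2) by simp
  then obtain e where e: "e \<in> carrier G" "e \<noteq> s \<otimes> inv (c \<otimes> c)"
    and nonsquare: "\<forall>x\<in>carrier G. x \<otimes> x \<noteq> e"
    using even_order_ex_nonsquare[OF n(1)] by blast
  define x where "x = s \<otimes> inv (c \<otimes> e)"
  have x: "x \<in> carrier G" using s c e(1) by (simp add: x_def)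
  have "s = x \<otimes> (c \<otimes> e)" using inv_solve_right[of x s "c \<otimes> e"] x s c e(1) x_def by blast
  then have product: "c \<otimes> (x \<otimes> e) = s" using x c e(1) by (simp add: m_ac)
  have "x \<noteq> c"
  proof
    assume "x = c"
    then have "e \<otimes> (c \<otimes> c) = s" using product c e(1) by (simp add: m_ac)
    then show False using e s c inv_solve_right[of e s "c \<otimes> c"] by simp
  qed
  let ?F = "{c, x}"
  have "card (?F \<union> (\<lambda>u. e \<otimes> inv u) ` ?F) \<le> 4" by (simp add: card_insert_if)
  moreover have "{u \<in> carrier G. u \<otimes> u = e} = {}" using nonsquare by blast
  then have "card {u \<in> carrier G. u \<otimes> u = e} = 0" by (simp only: card.empty)
  ultimately have "card (?F \<union> (\<lambda>u. e \<otimes> inv u) ` ?F) + card {u \<in> carrier G. u \<otimes> u = e} < order G"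
    using n(2) by linarith
  moreover have "?F \<subseteq> carrier G" using c x by simp
  ultimately obtain y z where "y \<in> carrier G - ?F" "z \<in> carrier G - ?F" "y \<noteq> z" "y \<otimes> z = e"
    using ex_distinct_factorization[OF e(1), of ?F] by blast
  then show ?thesis
    using c x \<open>x \<noteq> c\<close> product by (intro exI[of _ "{c, x, y, z}"]) auto
qed

lemma even_order_has_unit_subset_order_minus_4:
  assumes "even (order G)" "5 \<le> order G" "c \<in> carrier G"
  shows "has_unit_subset (carrier G - {c}) (order G - 4)"
proof -
  obtain X where X: "X \<subseteq> carrier G" "c \<in> X" "card X = 4" "(\<Otimes>x\<in>X. x) = (\<Otimes>x\<in>carrier G. x)"
    using even_order_ex_quadruple_with_product[OF assms finprod_subset_closed[OF subset_refl]]
    by blast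
  then have "has_unit_subset (carrier G - X) (order G - 4)"
    using has_unit_subset_complement[OF X(1,4)] by (simp only: X(3))
  then show ?thesis by (rule has_unit_subset_mono) (use X in blast)
qed

end

section \<open>Label sets for the edges at a vertex\<close>

context finite_comm_group
begin

definition star_labelable :: "'a set \<Rightarrow> nat \<Rightarrow> bool" where
  "star_labelable L d \<longleftrightarrow> (\<exists>S\<subseteq>L. card S = d \<and> (\<Otimes>x\<in>S. x) \<notin> S)"

text \<open>
  A vertex of degree \<open>d\<close> is reached by an edge labelled \<open>c\<close> from a vertex of weight \<open>w\<close>, and \<open>S\<close> is
  the set of all labels at it. Its label \<open>c\<close> may equal its weight, because the weight condition for
  that edge only concerns \<open>w\<close>.
\<close>
definition star_extendable :: "'a set \<Rightarrow> nat \<Rightarrow> bool" where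
  "star_extendable L d \<longleftrightarrow>
     (\<forall>c\<in>L. \<forall>w\<in>carrier G. c \<noteq> w \<longrightarrow>
       (\<exists>S\<subseteq>L. c \<in> S \<and> card S = d \<and> (\<Otimes>x\<in>S. x) \<noteq> w \<and> (\<Otimes>x\<in>S. x) \<notin> S - {c}))"

lemma star_labelable_if_has_unit_subset:
  "\<lbrakk>has_unit_subset L d; \<one> \<notin> L\<rbrakk> \<Longrightarrow> star_labelable L d"
  unfolding has_unit_subset_def star_labelable_def by (metis subsetD)

lemma star_labelable_mono: "\<lbrakk>star_labelable L d; L \<subseteq> M\<rbrakk> \<Longrightarrow> star_labelable M d"
  unfolding star_labelable_def by blast

lemma star_extendable_if_has_unit_subset:
  assumes L: "L \<subseteq> carrier G" and unit: "\<And>c. c \<in> L \<Longrightarrow> has_unit_subset (L - {c}) d"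
  shows "star_extendable L (Suc d)"
  unfolding star_extendable_def
proof (intro ballI impI)
  fix c w assume c: "c \<in> L" and "c \<noteq> w"
  obtain S where S: "S \<subseteq> L - {c}" "card S = d" "(\<Otimes>x\<in>S. x) = \<one>"
    using unit[OF c] unfolding has_unit_subset_def by blast
  have "S \<subseteq> carrier G" "c \<in> carrier G" using S(1) c L by auto
  moreover have "finite S" using \<open>S \<subseteq> carrier G\<close> by (rule finite_if_subset_carrier)
  moreover have "c \<notin> S" using S(1) by blast
  ultimately have "(\<Otimes>x\<in>insert c S. x) = c" "card (insert c S) = Suc d"
    using S(2,3) by (simp_all add: subset_iff Pi_iff)
  then show "\<exists>S\<subseteq>L. c \<in> S \<and> card S = Suc d \<and> (\<Otimes>x\<in>S. x) \<noteq> w \<and> (\<Otimes>x\<in>S. x) \<notin> S - {c}"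
    using S(1) c \<open>c \<noteq> w\<close> by (intro exI[of _ "insert c S"]) auto
qed

lemma star_extendable_1: "L \<subseteq> carrier G \<Longrightarrow> star_extendable L 1"
  using star_extendable_if_has_unit_subset[of L 0] has_unit_subset_0 by simp

lemma star_extendable_2:
  assumes n: "4 \<le> order G"
  shows "star_extendable (carrier G - {\<one>}) 2"
  unfolding star_extendable_def
proof (intro ballI impI)
  fix c w assume c: "c \<in> carrier G - {\<one>}" and w: "w \<in> carrier G"
  have "card {\<one>, c, inv c \<otimes> w} < card (carrier G)"
    using n by (simp add: order_def card_insert_if)
  then obtain x where x: "x \<in> carrier G" "x \<notin> {\<one>, c, inv c \<otimes> w}"
    using ex_mem_not_mem_if_card_less[of "{\<one>, c, inv c \<otimes> w}" "carrier G"] by blast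
  have "c \<otimes> x \<noteq> w" using x c w inv_solve_left[of x c w] by auto
  moreover have "c \<otimes> x \<noteq> x" using c x(1) by simp
  moreover have "(\<Otimes>y\<in>{c, x}. y) = c \<otimes> x" using c x by auto
  ultimately show "\<exists>S\<subseteq>carrier G - {\<one>}. c \<in> S \<and> card S = 2 \<and> (\<Otimes>x\<in>S. x) \<noteq> w \<and> (\<Otimes>x\<in>S. x) \<notin> S - {c}"
    using c x by (intro exI[of _ "{c, x}"]) auto
qed

lemma odd_order_star_labelable:
  assumes "odd (order G)" "2 \<le> d" "d + 3 \<le> order G"
  shows "star_labelable (carrier G - {\<one>}) d"
proof -
  have "card {\<one>} < card (carrier G)" using assms(3) by (simp add: order_def)
  then obtain c where c: "c \<in> carrier G" "c \<noteq> \<one>"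
    using ex_mem_not_mem_if_card_less[of "{\<one>}" "carrier G"] by blast
  have "has_unit_subset (carrier G - {\<one>, c}) d"
    by (rule odd_order_has_unit_subset[OF assms(1) c assms(2,3)])
  then have "has_unit_subset (carrier G - {\<one>}) d" by (rule has_unit_subset_mono) blast
  then show ?thesis by (rule star_labelable_if_has_unit_subset) blast
qed

lemma odd_order_star_extendable:
  assumes odd: "odd (order G)" and n: "5 \<le> order G" and d: "0 < d" "d + 2 \<le> order G"
  shows "star_extendable (carrier G - {\<one>}) d"
proof -
  consider (leaf) "d = 1" | (path) "d = 2" | (branch) m where "d = Suc m" "2 \<le> m"
    using d(1) by (cases d) force+
  then show ?thesis
  proof cases
    case leaf
    then show ?thesis using star_extendable_1[of "carrier G - {\<one>}"] by blast
  next
    case path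
    then show ?thesis using star_extendable_2 n by simp
  next
    case (branch m)
    have "has_unit_subset (carrier G - {\<one>} - {c}) m" if "c \<in> carrier G - {\<one>}" for c
    proof -
      have "carrier G - {\<one>} - {c} = carrier G - {\<one>, c}" by blast
      then show ?thesis
        using odd_order_has_unit_subset[OF odd _ _ branch(2)] that branch(1) d(2) by simp
    qed
    then show ?thesis unfolding branch(1) by (intro star_extendable_if_has_unit_subset) blast
  qed
qed

lemma odd_order_star_labelable_order_minus_2:
  assumes odd: "odd (order G)" and x: "x \<in> carrier G" "x [^] (3::nat) \<noteq> \<one>"
  shows "star_labelable (carrier G) (order G - 2)"
proof -
  let ?y = "inv (x \<otimes> x)" and ?S = "carrier G - {x, inv (x \<otimes> x)}"
  have "x \<otimes> (x \<otimes> x) \<noteq> \<one>" using x by (simp add: numeral_3_eq_3 m_assoc)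
  then have "x \<noteq> ?y" using x(1) r_inv[of "x \<otimes> x"] by (metis l_inv m_closed)
  then have "(\<Otimes>u\<in>{x, ?y}. u) = inv x" using x(1) by (simp add: inv_mult flip: m_assoc)
  then have "(\<Otimes>u\<in>?S. u) = x"
    using finprod_carrier_Diff[of "{x, ?y}"] x(1) odd_order_finprod_carrier[OF odd] by simp
  moreover have "card ?S = order G - 2"
    using x(1) \<open>x \<noteq> ?y\<close> by (subst card_carrier_Diff) auto
  ultimately show ?thesis unfolding star_labelable_def by (intro exI[of _ ?S]) simp
qed

lemma odd_order_star_extendable_order_minus_2:
  assumes "odd (order G)" "3 \<le> order G"
  shows "star_extendable (carrier G) (order G - 2)"
proof -
  have "has_unit_subset (carrier G - {c}) (order G - 3)" if "c \<in> carrier G" for c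
  proof -
    have "has_unit_subset (carrier G - {\<one>, c}) (order G - 3)"
      using odd_order_has_even_unit_subset[OF assms(1) that] assms by simp
    then show ?thesis by (rule has_unit_subset_mono) blast
  qed
  then have "star_extendable (carrier G) (Suc (order G - 3))"
    by (intro star_extendable_if_has_unit_subset) auto
  moreover have "Suc (order G - 3) = order G - 2" using assms(2) by simp
  ultimately show ?thesis by simp
qed

lemma star_labelable_order_minus_3:
  assumes "5 \<le> order G" "a \<in> carrier G" "a \<otimes> a \<noteq> \<one>"
  shows "star_labelable (carrier G) (order G - 3)"
  using star_labelable_if_has_unit_subset[OF has_unit_subset_order_minus_3[OF assms]]
  by (rule star_labelable_mono) auto

lemma even_order_star_extendable_order_minus_3:
  assumes "even (order G)" "5 \<le> order G"
  shows "star_extendable (carrier G) (order G - 3)"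
proof -
  have "star_extendable (carrier G) (Suc (order G - 4))"
    using even_order_has_unit_subset_order_minus_4[OF assms]
    by (intro star_extendable_if_has_unit_subset) auto
  moreover have "Suc (order G - 4) = order G - 3" using assms(2) by simp
  ultimately show ?thesis by simp
qed

end

section \<open>Greedy twin edge colourings\<close>

lemma ex_bij_betw_with_value:
  assumes "finite A" "finite B" "card A = card B" "a \<in> A" "b \<in> B"
  shows "\<exists>g. bij_betw g A B \<and> g a = b"
proof -
  obtain g where g: "bij_betw g A B" using finite_same_card_bij[OF assms(1-3)] by blast
  then obtain a' where a': "a' \<in> A" "g a' = b" using assms(5) by (auto simp: bij_betw_def)
  then have "bij_betw (g \<circ> transpose a a') A B"
    using g assms(4) bij_betw_trans[of "transpose a a'" A A g B] by simp
  then show ?thesis using a'(2) by (intro exI[of _ "g \<circ> transpose a a'"]) simp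
qed

lemma (in pair_graph) ex_relabel_star:
  assumes v: "v \<notin> U" and agree: "\<And>u. u \<in> neighbors G v \<inter> U \<Longrightarrow> g u = f {u, v}"
  shows "\<exists>f'. (\<forall>x\<in>neighbors G v. f' {x, v} = g x) \<and> (\<forall>u\<in>U. \<forall>x\<in>neighbors G u. f' {x, u} = f {x, u})"
proof -
  define f' where "f' e = (if v \<in> e then g (the_elem (e - {v})) else f e)" for e
  have at_v: "f' {x, v} = g x" if "x \<noteq> v" for x
    using that by (simp add: f'_def insert_Diff_if)
  have "f' {x, u} = f {x, u}" if "u \<in> U" "x \<in> neighbors G u" for u x
  proof (cases "x = v")
    case True
    then have u: "u \<in> neighbors G v \<inter> U" "u \<noteq> v" using that v neighbors_sym by blast+
    then show ?thesis using at_v[of u] agree[OF u(1)] True by (simp add: insert_commute)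
  next
    case False
    then show ?thesis using that(1) v by (auto simp: f'_def)
  qed
  moreover have "f' {x, v} = g x" if "x \<in> neighbors G v" for x
    using that neighbors_irrefl by (intro at_v) blast
  ultimately show ?thesis by blast
qed

locale group_labeling = pair_graph G + A: finite_comm_group A
  for G :: "'a pair_pre_digraph" and A (structure)
begin

abbreviation weight :: "('a set \<Rightarrow> 'b) \<Rightarrow> 'a \<Rightarrow> 'b" where
  "weight \<equiv> weighted_degree A G"

text \<open>
  For an edge leaving \<open>U\<close> the label stands in for the weight of its outer end, which will usually be
  equal to it.
\<close>
definition partial_twin_coloring :: "'b set \<Rightarrow> 'a set \<Rightarrow> ('a set \<Rightarrow> 'b) \<Rightarrow> bool" where
  "partial_twin_coloring L U f \<longleftrightarrow>
     (\<forall>u\<in>U. inj_on (\<lambda>x. f {x, u}) (neighbors G u) \<and>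
       (\<forall>x\<in>neighbors G u. f {x, u} \<in> L \<and>
         weight f u \<noteq> (if x \<in> U then weight f x else f {x, u})))"

lemma weight_closed:
  "(\<And>x. x \<in> neighbors G v \<Longrightarrow> f {x, v} \<in> carrier A) \<Longrightarrow> weight f v \<in> carrier A"
  unfolding weighted_degree_def by (rule A.finprod_closed) auto

lemma weight_cong:
  assumes "\<And>x. x \<in> neighbors G v \<Longrightarrow> f {x, v} = h x" "\<And>x. x \<in> neighbors G v \<Longrightarrow> h x \<in> carrier A"
  shows "weight f v = (\<Otimes>x\<in>neighbors G v. h x)"
  unfolding weighted_degree_def using assms by (intro A.finprod_cong') auto

lemma weight_bij_betw:
  assumes "bij_betw g (neighbors G v) S" "S \<subseteq> carrier A" "\<And>x. x \<in> neighbors G v \<Longrightarrow> f {x, v} = g x"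
  shows "weight f v = (\<Otimes>x\<in>S. x)"
proof -
  have S: "g ` neighbors G v = S" and inj: "inj_on g (neighbors G v)"
    using assms(1) by (auto simp: bij_betw_def)
  have "weight f v = (\<Otimes>x\<in>neighbors G v. g x)"
    using assms(2,3) S by (intro weight_cong) auto
  also have "\<dots> = (\<Otimes>x\<in>g ` neighbors G v. x)"
    using assms(2) S inj by (intro A.finprod_reindex[symmetric]) auto
  finally show ?thesis unfolding S .
qed

lemma partial_twin_coloring_insert:
  assumes L: "L \<subseteq> carrier A" and f: "partial_twin_coloring L U f" and v: "v \<notin> U"
    and g: "bij_betw g (neighbors G v) S" "S \<subseteq> L"
    and parents: "\<And>u. u \<in> neighbors G v \<inter> U \<Longrightarrow> g u = f {u, v} \<and> (\<Otimes>x\<in>S. x) \<noteq> weight f u"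
    and children: "\<And>x. x \<in> neighbors G v - U \<Longrightarrow> (\<Otimes>x\<in>S. x) \<noteq> g x"
  shows "\<exists>f. partial_twin_coloring L (insert v U) f"
proof -
  obtain f' where f'v: "\<And>x. x \<in> neighbors G v \<Longrightarrow> f' {x, v} = g x"
    and f'U: "\<And>u x. \<lbrakk>u \<in> U; x \<in> neighbors G u\<rbrakk> \<Longrightarrow> f' {x, u} = f {x, u}"
    using ex_relabel_star[OF v, of g f] parents by blast
  have gL: "g x \<in> L" if "x \<in> neighbors G v" for x using g that by (auto simp: bij_betw_def)
  have weight_U: "weight f' u = weight f u" if u: "u \<in> U" for u
    using f L u f'U[OF u] weight_cong[of u f' "\<lambda>x. f {x, u}"]
    by (auto simp: partial_twin_coloring_def weighted_degree_def)
  have weight_v: "weight f' v = (\<Otimes>x\<in>S. x)" using g L f'v by (intro weight_bij_betw) auto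
  have "partial_twin_coloring L (insert v U) f'"
    unfolding partial_twin_coloring_def
  proof (intro ballI conjI)
    fix y assume y: "y \<in> insert v U"
    show "inj_on (\<lambda>x. f' {x, y}) (neighbors G y)"
      using y g(1) f f'v f'U[of y] by (auto simp: bij_betw_def partial_twin_coloring_def inj_on_def)
    fix x assume x: "x \<in> neighbors G y"
    show "f' {x, y} \<in> L"
      using y x gL f f'v f'U[of y x] by (auto simp: partial_twin_coloring_def)
    show "weight f' y \<noteq> (if x \<in> insert v U then weight f' x else f' {x, y})"
    proof (cases "y = v")
      case True
      then show ?thesis
        using x parents[of x] children[of x] f'v[of x] weight_v weight_U[of x] neighbors_irrefl
        by auto
    next
      case False
      then have "y \<in> U" using y by blast
      then have "weight f y \<noteq> (if x \<in> U then weight f x else f {x, y})"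
        using f x by (simp add: partial_twin_coloring_def)
      then show ?thesis
        using \<open>y \<in> U\<close> x parents[of y] neighbors_sym[of y v] weight_v weight_U f'U[of y x] v by auto
    qed
  qed
  then show ?thesis by blast
qed

lemma partial_twin_coloring_root:
  assumes L: "L \<subseteq> carrier A" and label: "A.star_labelable L (vdegree G r)"
  shows "\<exists>f. partial_twin_coloring L {r} f"
proof -
  obtain S where S: "S \<subseteq> L" "card S = card (neighbors G r)" "(\<Otimes>x\<in>S. x) \<notin> S"
    using label unfolding A.star_labelable_def vdegree_eq_card_neighbors by blast
  have "finite S" using S(1) L A.finite_if_subset_carrier by blast
  then obtain g where g: "bij_betw g (neighbors G r) S"
    using finite_same_card_bij[OF finite_neighbors] S(2) by metis
  have empty: "partial_twin_coloring L {} f" for f by (simp add: partial_twin_coloring_def)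
  show ?thesis
  proof (rule partial_twin_coloring_insert[OF L empty _ g S(1)])
    show "(\<Otimes>x\<in>S. x) \<noteq> g x" if "x \<in> neighbors G r - {}" for x
      using that S(3) g by (auto simp: bij_betw_def)
  qed auto
qed

lemma partial_twin_coloring_grow:
  assumes L: "L \<subseteq> carrier A" and f: "partial_twin_coloring L U f"
    and v: "v \<notin> U" "neighbors G v \<inter> U = {u}" and extend: "A.star_extendable L (vdegree G v)"
  shows "\<exists>f. partial_twin_coloring L (insert v U) f"
proof -
  have u: "u \<in> U" "u \<in> neighbors G v" "v \<in> neighbors G u" using v(2) neighbors_sym by blast+
  have at_u: "\<forall>x\<in>neighbors G u. f {x, u} \<in> L \<and>
      weight f u \<noteq> (if x \<in> U then weight f x else f {x, u})"
    using f u(1) by (simp add: partial_twin_coloring_def)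
  then have label_vu: "f {v, u} \<in> L" "f {v, u} \<noteq> weight f u" using u(3) v(1) by force+
  have "weight f u \<in> carrier A" using at_u L by (intro weight_closed) blast
  then obtain S where S: "S \<subseteq> L" "f {v, u} \<in> S" "card S = card (neighbors G v)"
    "(\<Otimes>x\<in>S. x) \<noteq> weight f u" "(\<Otimes>x\<in>S. x) \<notin> S - {f {v, u}}"
    using label_vu extend unfolding A.star_extendable_def vdegree_eq_card_neighbors by metis
  have "finite S" using S(1) L A.finite_if_subset_carrier by blast
  then obtain g where g: "bij_betw g (neighbors G v) S" "g u = f {v, u}"
    using ex_bij_betw_with_value[OF finite_neighbors _ S(3)[symmetric] u(2) S(2)] by blast
  show ?thesis
  proof (rule partial_twin_coloring_insert[OF L f v(1) g(1) S(1)])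
    show "g y = f {y, v} \<and> (\<Otimes>x\<in>S. x) \<noteq> weight f y" if "y \<in> neighbors G v \<inter> U" for y
      using that v(2) g(2) S(4) by (simp add: insert_commute)
    show "(\<Otimes>x\<in>S. x) \<noteq> g x" if x: "x \<in> neighbors G v - U" for x
    proof -
      have "x \<noteq> u" using x u(1) by blast
      then have "g x \<in> S - {f {v, u}}"
        using g x u(2) by (auto simp: bij_betw_def inj_on_def)
      then show ?thesis using S(5) by auto
    qed
  qed
qed

lemma twin_edge_coloring_if_partial:
  assumes L: "L \<subseteq> carrier A" and f: "partial_twin_coloring L (pverts G) f"
  shows "twin_edge_coloring A G f"
proof -
  have at_vertex: "inj_on (\<lambda>x. f {x, u}) (neighbors G u) \<and>
      (\<forall>x\<in>neighbors G u. f {x, u} \<in> L \<and> weight f u \<noteq> weight f x)" for u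
  proof (cases "u \<in> pverts G")
    case True
    then show ?thesis
      using f neighbors_subset_pverts[of u] by (fastforce simp: partial_twin_coloring_def)
  qed (simp add: neighbors_eq_empty)
  show ?thesis
    unfolding twin_edge_coloring_def proper_edge_labeling_def
  proof (intro conjI ballI allI impI)
    fix e assume e: "e \<in> edges G"
    then obtain v where "v \<in> e" by (auto simp: edges_def)
    then obtain u where "u \<in> neighbors G v" "e = {u, v}" using edge_at_vertex[OF e] by blast
    then show "f e \<in> carrier A" using at_vertex L by blast
  next
    fix e e' assume e: "e \<in> edges G" and e': "e' \<in> edges G" and adj: "e \<noteq> e' \<and> e \<inter> e' \<noteq> {}"
    then obtain v where v: "v \<in> e" "v \<in> e'" by blast
    obtain x y where "x \<in> neighbors G v" "e = {x, v}" "y \<in> neighbors G v" "e' = {y, v}"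
      using edge_at_vertex[OF e v(1)] edge_at_vertex[OF e' v(2)] by blast
    moreover have "inj_on (\<lambda>x. f {x, v}) (neighbors G v)" using at_vertex by blast
    ultimately show "f e \<noteq> f e'" using adj by (auto dest: inj_onD)
  next
    fix u v assume "{u, v} \<in> edges G"
    then show "weight f u \<noteq> weight f v" using at_vertex in_edges_iff by metis
  qed
qed

lemma twin_edge_coloring_greedy:
  assumes T: "undirected_tree G" and r: "r \<in> pverts G" and L: "L \<subseteq> carrier A"
    and label: "A.star_labelable L (vdegree G r)"
    and extend: "\<And>v. v \<in> pverts G - {r} \<Longrightarrow> A.star_extendable L (vdegree G v)"
  shows "\<exists>f. twin_edge_coloring A G f"
proof -
  have "\<exists>f. partial_twin_coloring L (pverts G) f"
    using T r
  proof (induction rule: undirected_tree_induct)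
    case root
    show ?case using L label by (rule partial_twin_coloring_root)
  next
    case (grow U u v)
    then show ?case using partial_twin_coloring_grow[OF L] extend by blast
  qed
  then show ?thesis using twin_edge_coloring_if_partial[OF L] by blast
qed

end

section \<open>Twin chromatic index of trees\<close>

context group_labeling
begin

lemma twin_edge_coloring_odd_order:
  assumes T: "undirected_tree G" and odd: "odd (order A)"
    and deg: "\<And>v. v \<in> pverts G \<Longrightarrow> 0 < vdegree G v \<and> vdegree G v + 2 \<le> order A"
    and r: "r \<in> pverts G" "2 \<le> vdegree G r" "vdegree G r + 3 \<le> order A"
  shows "\<exists>f. twin_edge_coloring A G f"
proof (rule twin_edge_coloring_greedy[OF T r(1)])
  have n: "5 \<le> order A" using r(2,3) by linarith
  show "A.star_labelable (carrier A - {\<one>}) (vdegree G r)"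
    by (rule A.odd_order_star_labelable[OF odd r(2,3)])
  show "A.star_extendable (carrier A - {\<one>}) (vdegree G v)" if "v \<in> pverts G - {r}" for v
    using deg[of v] that by (intro A.odd_order_star_extendable[OF odd n]) auto
qed blast

lemma twin_edge_coloring_regular:
  assumes T: "regular_tree d G" and card: "3 \<le> card (pverts G)"
    and root: "A.star_labelable (carrier A) d" and grow: "A.star_extendable (carrier A) d"
  shows "\<exists>f. twin_edge_coloring A G f"
proof -
  have tree: "undirected_tree G" using T by (rule regular_tree_imp_undirected_tree)
  have deg: "vdegree G v = 1 \<or> vdegree G v = d" if "v \<in> pverts G" for v
    using T that by (auto simp: regular_tree_def)
  obtain r where r: "r \<in> pverts G" "2 \<le> vdegree G r"
    using connected_ex_vdegree_ge_2[OF undirected_treeD(2)[OF tree] card] by blast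
  show ?thesis
  proof (rule twin_edge_coloring_greedy[OF tree r(1)])
    show "A.star_labelable (carrier A) (vdegree G r)" using root deg[OF r(1)] r(2) by auto
    show "A.star_extendable (carrier A) (vdegree G v)" if "v \<in> pverts G - {r}" for v
      using deg[of v] that grow A.star_extendable_1[of "carrier A"] by auto
  qed blast
qed

end

lemma group_twin_chromatic_index_le:
  assumes T: "pair_graph T" and k: "2 \<le> k"
    and col: "\<And>A :: nat monoid. \<lbrakk>group_labeling T A; order A = k\<rbrakk> \<Longrightarrow> \<exists>f. twin_edge_coloring A T f"
  shows "group_twin_chromatic_index T \<le> enat k"
proof -
  have "group_labeling T A" if "comm_group A" "order A = k" for A :: "nat monoid"
  proof -
    interpret comm_group A by fact
    have "finite (carrier A)" using k that(2) order_gt_0_iff_finite by auto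
    then show ?thesis
      using T that(1)
      by (simp add: group_labeling_def finite_comm_group_def finite_comm_group_axioms_def)
  qed
  then have "twin_colorable T k" using col by (simp add: twin_colorable_def)
  then show ?thesis
    using k unfolding group_twin_chromatic_index_def by (intro Inf_lower) blast
qed

context pair_graph
begin

lemma vdegree_le_max_degree: "v \<in> pverts G \<Longrightarrow> vdegree G v \<le> max_degree G"
  by (simp add: max_degree_def)

lemma max_degree_attained:
  assumes "pverts G \<noteq> {}"
  shows "\<exists>v\<in>pverts G. vdegree G v = max_degree G"
proof -
  have "max_degree G \<in> vdegree G ` pverts G"
    unfolding max_degree_def using assms by (intro Max_in) auto
  then show ?thesis by force
qed

lemma connected_max_degree_ge_2:
  assumes "connected (with_proj G)" "3 \<le> card (pverts G)"
  shows "2 \<le> max_degree G"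
proof -
  obtain v where "v \<in> pverts G" "2 \<le> vdegree G v"
    using connected_ex_vdegree_ge_2[OF assms] by blast
  then show ?thesis using vdegree_le_max_degree le_trans by blast
qed

end

lemma regular_tree_max_degree:
  assumes d: "regular_tree d T" and card: "3 \<le> card (pverts T)"
  shows "max_degree T = d"
proof -
  note tree = undirected_treeD[OF regular_tree_imp_undirected_tree[OF d]]
  interpret pair_graph T by (rule tree)
  have "max_degree T \<noteq> 1" using connected_max_degree_ge_2[OF tree(2) card] by linarith
  moreover have "pverts T \<noteq> {}" using card by auto
  ultimately show ?thesis using max_degree_attained d by (auto simp: regular_tree_def)
qed

lemma group_twin_chromatic_index_le_odd:
  assumes T: "undirected_tree T" and card: "3 \<le> card (pverts T)"
    and k: "odd k" "max_degree T + 2 \<le> k"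
    and r: "r \<in> pverts T" "2 \<le> vdegree T r" "vdegree T r + 3 \<le> k"
  shows "group_twin_chromatic_index T \<le> enat k"
proof (rule group_twin_chromatic_index_le[OF undirected_treeD(1)[OF T]])
  show "2 \<le> k" using k(2) by simp
  fix A :: "nat monoid" assume "group_labeling T A" and ord: "order A = k"
  then interpret group_labeling T A by simp
  have deg: "0 < vdegree T v \<and> vdegree T v + 2 \<le> order A" if "v \<in> pverts T" for v
    using connected_vdegree_pos[OF undirected_treeD(2)[OF T] _ that] card
      vdegree_le_max_degree[OF that] k(2) ord by linarith
  show "\<exists>f. twin_edge_coloring A T f"
    by (rule twin_edge_coloring_odd_order[OF T _ deg r(1,2)]) (use k(1) r ord in auto)
qed

lemma group_twin_chromatic_index_le_even_max_degree:
  assumes T: "undirected_tree T" and card: "3 \<le> card (pverts T)" and even: "even (max_degree T)"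
  shows "group_twin_chromatic_index T \<le> enat (max_degree T + 3)"
proof -
  interpret pair_graph T using T by (rule undirected_treeD)
  have "pverts T \<noteq> {}" using card by auto
  then obtain r where "r \<in> pverts T" "vdegree T r = max_degree T" using max_degree_attained by blast
  then show ?thesis
    using connected_max_degree_ge_2[OF undirected_treeD(2)[OF T] card] even
    by (intro group_twin_chromatic_index_le_odd[OF T card, of _ r]) auto
qed

lemma group_twin_chromatic_index_le_irregular:
  assumes T: "undirected_tree T" and card: "3 \<le> card (pverts T)"
    and odd: "odd (max_degree T)" and irregular: "\<not> regular_tree (max_degree T) T"
  shows "group_twin_chromatic_index T \<le> enat (max_degree T + 2)"
proof -
  interpret pair_graph T using T by (rule undirected_treeD)
  note con = undirected_treeD(2)[OF T]
  obtain v where v: "v \<in> pverts T" "vdegree T v \<noteq> 1" "vdegree T v \<noteq> max_degree T"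
    using irregular T connected_max_degree_ge_2[OF con card] unfolding regular_tree_def by blast
  have "0 < vdegree T v" using connected_vdegree_pos[OF con _ v(1)] card by linarith
  then have "2 \<le> vdegree T v" "vdegree T v < max_degree T"
    using v vdegree_le_max_degree[OF v(1)] by linarith+
  then show ?thesis
    using odd by (intro group_twin_chromatic_index_le_odd[OF T card _ _ v(1)]) auto
qed

lemma plus_2_neq_three_power:
  fixes d :: nat
  assumes "odd d" "2 \<le> d" and d: "\<And>p. 2 \<le> p \<Longrightarrow> d \<noteq> 3 ^ p - 2"
  shows "d + 2 \<noteq> 3 ^ k"
proof
  assume eq: "d + 2 = 3 ^ k"
  then have "d = 3 ^ k - 2" by simp
  then have "\<not> 2 \<le> k" using d by blast
  then have "k = 0 \<or> k = 1" by linarith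
  then show False using assms(1,2) eq by auto
qed

lemma regular_tree_group_twin_chromatic_index_le_plus_2:
  assumes T: "regular_tree d T" and card: "3 \<le> card (pverts T)"
    and d: "odd d" "\<And>p. 2 \<le> p \<Longrightarrow> d \<noteq> 3 ^ p - 2"
  shows "group_twin_chromatic_index T \<le> enat (d + 2)"
proof (rule group_twin_chromatic_index_le)
  show "pair_graph T" using T by (intro undirected_treeD regular_tree_imp_undirected_tree)
  fix A :: "nat monoid" assume "group_labeling T A" and ord: "order A = d + 2"
  then interpret group_labeling T A by simp
  have order: "odd (order A)" "3 \<le> order A" and d_eq: "order A - 2 = d"
    using ord d(1) T by (auto simp: regular_tree_def)
  have "2 \<le> d" using T by (simp add: regular_tree_def)
  then have "order A \<noteq> 3 ^ k" for k using plus_2_neq_three_power[OF d(1) _ d(2)] ord by metis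
  then obtain x where x: "x \<in> carrier A" "x [^]\<^bsub>A\<^esub> (3::nat) \<noteq> \<one>\<^bsub>A\<^esub>"
    using A.ex_pow_prime_neq_one[OF A.finite_carrier, of 3] by auto
  show "\<exists>f. twin_edge_coloring A T f"
    using A.odd_order_star_labelable_order_minus_2[OF order(1) x]
      A.odd_order_star_extendable_order_minus_2[OF order]
    unfolding d_eq by (rule twin_edge_coloring_regular[OF T card])
qed simp

lemma regular_tree_group_twin_chromatic_index_le_plus_3:
  assumes T: "regular_tree d T" and card: "3 \<le> card (pverts T)"
    and d: "odd d" "\<And>k. d + 3 \<noteq> 2 ^ k"
  shows "group_twin_chromatic_index T \<le> enat (d + 3)"
proof (rule group_twin_chromatic_index_le)
  show "pair_graph T" using T by (intro undirected_treeD regular_tree_imp_undirected_tree)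
  fix A :: "nat monoid" assume "group_labeling T A" and ord: "order A = d + 3"
  then interpret group_labeling T A by simp
  have order: "even (order A)" "5 \<le> order A" and d_eq: "order A - 3 = d"
    using ord d(1) T by (auto simp: regular_tree_def)
  have "order A \<noteq> 2 ^ k" for k using d(2) ord by metis
  then obtain x where x: "x \<in> carrier A" "x [^]\<^bsub>A\<^esub> (2::nat) \<noteq> \<one>\<^bsub>A\<^esub>"
    using A.ex_pow_prime_neq_one[OF A.finite_carrier two_is_prime_nat] by blast
  have "x \<otimes>\<^bsub>A\<^esub> x \<noteq> \<one>\<^bsub>A\<^esub>" using x A.pow_numeral_2[OF x(1)] by simp
  then have "A.star_labelable (carrier A) (order A - 3)"
    by (rule A.star_labelable_order_minus_3[OF order(2) x(1)])
  then show "\<exists>f. twin_edge_coloring A T f"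
    using A.even_order_star_extendable_order_minus_3[OF order]
    unfolding d_eq by (rule twin_edge_coloring_regular[OF T card])
qed simp

lemma three_power_plus_1_neq_two_power:
  assumes "2 \<le> p"
  shows "(3::nat) ^ p + 1 \<noteq> 2 ^ k"
proof
  assume eq: "(3::nat) ^ p + 1 = 2 ^ k"
  have "(3::nat) ^ 2 \<le> 3 ^ p" using assms by (intro power_increasing) auto
  then have "(2::nat) ^ 3 \<le> 2 ^ k" using eq by simp
  then have "3 \<le> k" by (simp only: power_increasing_iff)
  then have "(2::nat) ^ 3 dvd 3 ^ p + 1" unfolding eq by (rule le_imp_power_dvd)
  then have "(8::nat) dvd 3 ^ p + 1" by simp
  moreover have "(3::nat) ^ p mod 8 = 1 \<or> (3::nat) ^ p mod 8 = 3"
  proof (induction p)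
    case (Suc p)
    then show ?case unfolding power_Suc by presburger
  qed simp
  ultimately show False by presburger
qed

theorem theorem4:
  fixes T :: "'a pair_pre_digraph"
  assumes "undirected_tree T"
    and "3 \<le> card (pverts T)"
  shows "if odd (max_degree T) \<and> \<not> (\<exists>p\<ge>2. regular_tree (3 ^ p - 2) T)
         then group_twin_chromatic_index T \<le> enat (max_degree T + 2)
         else group_twin_chromatic_index T \<le> enat (max_degree T + 3)"
proof -
  let ?D = "max_degree T"
  consider (even) "even ?D" | (irregular) "odd ?D" "\<not> regular_tree ?D T"
    | (regular) "odd ?D" "regular_tree ?D T" "\<And>p. 2 \<le> p \<Longrightarrow> ?D \<noteq> 3 ^ p - 2"
    | (exceptional) p where "odd ?D" "regular_tree ?D T" "2 \<le> p" "?D = 3 ^ p - 2"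
    by metis
  then show ?thesis
  proof cases
    case even
    then show ?thesis using group_twin_chromatic_index_le_even_max_degree[OF assms] by simp
  next
    case irregular
    then show ?thesis
      using group_twin_chromatic_index_le_irregular[OF assms] regular_tree_max_degree assms(2)
      by metis
  next
    case regular
    then show ?thesis
      using regular_tree_group_twin_chromatic_index_le_plus_2 regular_tree_max_degree assms(2)
      by metis
  next
    case (exceptional p)
    then have "?D + 3 = 3 ^ p + 1" by (auto simp: regular_tree_def)
    then have "?D + 3 \<noteq> 2 ^ k" for k
      using three_power_plus_1_neq_two_power[OF exceptional(3)] by metis
    then have "group_twin_chromatic_index T \<le> enat (?D + 3)"
      using exceptional(1,2) assms(2) by (intro regular_tree_group_twin_chromatic_index_le_plus_3)
    then show ?thesis using exceptional by auto
  qed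
qed

end
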